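(* Let $d\ge 1$ be an integer and let $X=\nu_d(\mathbb{P}^2)\subset\mathbb{P}^N$, $N=d(d+3)/2$, be the $d$-th Veronese variety of the complex projective plane. Let $P\in\mathbb{P}^N$ be a point of rank $k$ (with respect to $X$), and let $P=P_1+\cdots+P_k$ with $P_i=\nu_d(x_i)$, $x_i\in\mathbb{P}^2$. Assume that the set $Z=\{x_1,\dots,x_k\}\subset\mathbb{P}^2$ has general uniform position (GUP) and that $$k<\frac{d^2+2d}{8}.$$ Then $P$ is identifiable.
   Context: All projective spaces are over $\mathbb{C}$. $\nu_d:\mathbb{P}^2\to\mathbb{P}^N$, $N=\binom{d+2}{2}-1=d(d+3)/2$, is the $d$-th Veronese map (given by all monomials of degree $d$). $\mathbb{P}^N$ is regarded as the space of symmetric tensors of type $3\times\cdots\times 3$ ($d$ times) up to scalar multiplication, and $X=\nu_d(\mathbb{P}^2)$ as the set of decomposable symmetric tensors up to scalar. An expression $P=P_1+\cdots+P_k$ with $P_i\in X$ is understood up to scalars: a vector representing $P$ is the sum of suitable vectors representing $P_1,\dots,P_k$. The rank of $P\in\mathbb{P}^N$ is the minimum $k$ for which such an expression exists; equivalently, the minimum $k$ such that $P$ lies in the linear span $\langle P_1,\dots,P_k\rangle$ of $k$ points of $X$. A point $P\in\mathbb{P}^N$ of rank $k$ is identifiable if there is a unique expression of $P$, up to scaling and permutations, as a sum of $k$ elements of $X$; that is, there is a unique set $\{P_1,\dots,P_k\}\subset X$ of $k$ points with $P\in\langle P_1,\dots,P_k\rangle$. A set $Z$ of $k$ distinct points in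 $\mathbb{P}^n$ (here $n=2$) has general uniform position (GUP) if for any $m=1,\dots,k$, no subset $Z'\subset Z$ of length (cardinality) $m$ is contained in a hypersurface of degree $u$, as soon as $m\ge\binom{u+n}{n}$. *)

theory Defs
  imports Complex_Main "HOL-Library.Function_Algebras" "HOL-Library.FuncSet"
begin

section \<open>Projective spaces\<close>

text \<open>Vectors are functions \<^typ>\<open>'i \<Rightarrow> complex\<close> with pointwise addition, supported on a coordinate
  set \<^term>\<open>I\<close>. In this way the dimension of the projective space may depend on a term.\<close>

definition cscale :: "complex \<Rightarrow> ('i \<Rightarrow> complex) \<Rightarrow> 'i \<Rightarrow> complex" where
  "cscale c v = (\<lambda>i. c * v i)"

global_interpretation cvec: vector_space "cscale :: complex \<Rightarrow> ('i \<Rightarrow> complex) \<Rightarrow> 'i \<Rightarrow> complex"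
  by unfold_locales (auto simp: cscale_def fun_eq_iff algebra_simps)

definition coord_space :: "'i set \<Rightarrow> ('i \<Rightarrow> complex) set" where
  "coord_space I = {v. \<forall>i. i \<notin> I \<longrightarrow> v i = 0}"

text \<open>A projective point is the line through the origin that it represents.\<close>

definition proj_space :: "'i set \<Rightarrow> ('i \<Rightarrow> complex) set set" where
  "proj_space I = {cvec.span {v} | v. v \<in> coord_space I \<and> v \<noteq> 0}"

abbreviation PP :: "nat \<Rightarrow> (nat \<Rightarrow> complex) set set" where
  "PP n \<equiv> proj_space {..n}"

text \<open>Since points are lines, \<^term>\<open>\<Union>S\<close> is the set of all vectors representing points of \<^term>\<open>S\<close>,
  together with 0.\<close>

definition in_linear_span :: "('i \<Rightarrow> complex) set \<Rightarrow> ('i \<Rightarrow> complex) set set \<Rightarrow> bool" where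
  "in_linear_span P S \<longleftrightarrow> P \<subseteq> cvec.span (\<Union>S)"

section \<open>Monomials, hypersurfaces and the Veronese map\<close>

definition exponents :: "nat \<Rightarrow> nat \<Rightarrow> (nat \<Rightarrow> nat) set" where
  "exponents n d = {a. (\<forall>i. i \<notin> {..n} \<longrightarrow> a i = 0) \<and> (\<Sum>i\<le>n. a i) = d}"

definition monomial :: "nat \<Rightarrow> (nat \<Rightarrow> complex) \<Rightarrow> (nat \<Rightarrow> nat) \<Rightarrow> complex" where
  "monomial n v a = (\<Prod>i\<le>n. v i ^ a i)"

text \<open>A form of degree \<^term>\<open>u\<close> in \<^term>\<open>n + 1\<close> variables is given by its coefficient vector
  \<^term>\<open>F \<in> coord_space (exponents n u)\<close>.\<close>

definition form_eval :: "nat \<Rightarrow> nat \<Rightarrow> ((nat \<Rightarrow> nat) \<Rightarrow> complex) \<Rightarrow> (nat \<Rightarrow> complex) \<Rightarrow> complex" where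
  "form_eval n u F v = (\<Sum>a\<in>exponents n u. F a * monomial n v a)"

definition is_hypersurface :: "nat \<Rightarrow> nat \<Rightarrow> (nat \<Rightarrow> complex) set set \<Rightarrow> bool" where
  "is_hypersurface n u H \<longleftrightarrow>
     (\<exists>F\<in>coord_space (exponents n u). F \<noteq> 0 \<and> H = {x \<in> PP n. \<forall>v\<in>x. form_eval n u F v = 0})"

text \<open>The target of the Veronese map is the projective space whose coordinates are the monomials
  of degree \<^term>\<open>d\<close>; see \<open>card_exponents\<close> below for its dimension.\<close>

abbreviation veronese_target :: "nat \<Rightarrow> nat \<Rightarrow> ((nat \<Rightarrow> nat) \<Rightarrow> complex) set set" where
  "veronese_target n d \<equiv> proj_space (exponents n d)"

definition veronese_vec :: "nat \<Rightarrow> nat \<Rightarrow> (nat \<Rightarrow> complex) \<Rightarrow> (nat \<Rightarrow> nat) \<Rightarrow> complex" where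
  "veronese_vec n d v = (\<lambda>a. if a \<in> exponents n d then monomial n v a else 0)"

definition veronese :: "nat \<Rightarrow> nat \<Rightarrow> (nat \<Rightarrow> complex) set \<Rightarrow> ((nat \<Rightarrow> nat) \<Rightarrow> complex) set" where
  "veronese n d x = cvec.span (veronese_vec n d ` x)"

definition veronese_variety :: "nat \<Rightarrow> nat \<Rightarrow> ((nat \<Rightarrow> nat) \<Rightarrow> complex) set set" where
  "veronese_variety n d = veronese n d ` PP n"

section \<open>Rank, identifiability and general uniform position\<close>

text \<open>\<open>is_expression P Ps\<close>: the point \<^term>\<open>P\<close> equals the sum of the points \<^term>\<open>Ps\<close>, up to scalars,
  i.e. some choice of nonzero representatives \<^term>\<open>vs\<close> of the summands sums to a representative of \<^term>\<open>P\<close>.\<close>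

definition is_expression :: "('i \<Rightarrow> complex) set \<Rightarrow> ('i \<Rightarrow> complex) set list \<Rightarrow> bool" where
  "is_expression P Ps \<longleftrightarrow>
     (\<exists>vs. list_all2 (\<lambda>v Q. v \<in> Q \<and> v \<noteq> 0) vs Ps \<and> sum_list vs \<in> P \<and> sum_list vs \<noteq> 0)"

definition veronese_rank :: "nat \<Rightarrow> nat \<Rightarrow> ((nat \<Rightarrow> nat) \<Rightarrow> complex) set \<Rightarrow> nat" where
  "veronese_rank n d P =
     (LEAST k. \<exists>Ps. length Ps = k \<and> set Ps \<subseteq> veronese_variety n d \<and> is_expression P Ps)"

definition identifiable :: "nat \<Rightarrow> nat \<Rightarrow> ((nat \<Rightarrow> nat) \<Rightarrow> complex) set \<Rightarrow> bool" where
  "identifiable n d P \<longleftrightarrow>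
     (\<exists>!S. S \<subseteq> veronese_variety n d \<and> finite S \<and> card S = veronese_rank n d P \<and> in_linear_span P S)"

definition GUP :: "nat \<Rightarrow> (nat \<Rightarrow> complex) set set \<Rightarrow> bool" where
  "GUP n Z \<longleftrightarrow> finite Z \<and> Z \<subseteq> PP n \<and>
     (\<forall>m\<in>{1..card Z}. \<forall>Z'\<subseteq>Z. card Z' = m \<longrightarrow>
        (\<forall>u. m \<ge> (u + n) choose n \<longrightarrow> \<not> (\<exists>H. is_hypersurface n u H \<and> Z' \<subseteq> H)))"

section \<open>Sanity checks\<close>

lemma bij_betw_exponents:
  "bij_betw (\<lambda>a. map a [0..<Suc n]) (exponents n d) {l. length l = Suc n \<and> sum_list l = d}"
proof (rule bij_betwI[where g = "\<lambda>l i. if i \<le> n then l ! i else 0"])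
  show "(\<lambda>a. map a [0..<Suc n]) \<in> exponents n d \<rightarrow> {l. length l = Suc n \<and> sum_list l = d}"
    by (auto simp: exponents_def interv_sum_list_conv_sum_set_nat atLeast0LessThan
        lessThan_Suc_atMost simp del: upt_Suc)
  show "(\<lambda>l i. if i \<le> n then l ! i else 0) \<in> {l. length l = Suc n \<and> sum_list l = d} \<rightarrow> exponents n d"
    by (auto simp: exponents_def sum_list_sum_nth atLeast0LessThan lessThan_Suc_atMost)
qed (auto simp: exponents_def fun_eq_iff intro!: nth_equalityI simp del: upt_Suc)

lemma card_exponents: "card (exponents n d) = (n + d) choose n"
  using bij_betw_same_card[OF bij_betw_exponents, of n d]
  using binomial_symmetric[of n "n + d"] by (simp add: card_length_sum_list add.commute)

lemma finite_exponents: "finite (exponents n d)"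
  using card_exponents[of n d] card_ge_0_finite[of "exponents n d"] by simp

lemma card_exponents_plane: "card (exponents 2 d) = Suc (d * (d + 3) div 2)"
  by (simp add: card_exponents choose_two algebra_simps)

lemma veronese_vec_scale: "veronese_vec n d (cscale c v) = cscale (c ^ d) (veronese_vec n d v)"
  by (auto simp: veronese_vec_def monomial_def cscale_def fun_eq_iff power_mult_distrib
      prod.distrib exponents_def power_sum)

lemma veronese_span: "veronese n d (cvec.span {v}) = cvec.span {veronese_vec n d v}"
proof -
  have "veronese_vec n d ` cvec.span {v} \<subseteq> cvec.span {veronese_vec n d v}"
    by (auto simp: cvec.span_singleton veronese_vec_scale)
  moreover have "veronese_vec n d v \<in> veronese_vec n d ` cvec.span {v}"
    by (simp add: cvec.span_base)
  ultimately show ?thesis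
    unfolding veronese_def
    by (intro antisym cvec.span_minimal cvec.subspace_span) (auto intro: cvec.span_base)
qed

lemma veronese_variety_subset: "veronese_variety n d \<subseteq> veronese_target n d"
proof -
  have "veronese_vec n d v \<noteq> 0" if v: "v \<in> coord_space {..n}" "v \<noteq> 0" for v
  proof -
    from v obtain j where j: "j \<le> n" "v j \<noteq> 0"
      by (auto simp: coord_space_def fun_eq_iff)
    define a where "a = (\<lambda>i. if i = j then d else 0)"
    have "a \<in> exponents n d" "monomial n v a = v j ^ d"
      using j by (auto simp: a_def exponents_def monomial_def if_distrib cong: if_cong)
    with j have "veronese_vec n d v a \<noteq> 0"
      by (simp add: veronese_vec_def)
    then show ?thesis by auto
  qed
  moreover have "veronese_vec n d v \<in> coord_space (exponents n d)" for v
    by (simp add: veronese_vec_def coord_space_def)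
  ultimately show ?thesis
    by (fastforce simp: veronese_variety_def proj_space_def veronese_span)
qed

end

theory Submission
  imports Defs "HOL-Library.Nat_Bijection"
begin

text \<open>Suppose that \<open>P\<close> has two different decompositions of length equal to its rank. Their difference is
a linear relation $\sum_{p \in B} c_p \nu_d(p) = 0$ with all $c_p \neq 0$; in other words, the functional
$F \mapsto \sum_p c_p F(p)$ kills all forms of degree $d$. Let $m$ be the number of points of $B$
that belong to the given set $Z$. As the two decompositions have the same size,
$|B| \<le> 2 m$. A lower bound for $|B|$ contradicts this.

The lower bound comes from the Hilbert function $h(i)$ of $B$, the dimension of the space of
functions on $B$ given by forms of degree $i$. Let $s$ be the largest degree with
$(s + 1) (s + 2) / 2 \<le> m$. General uniform position says that no curve of degree $s$ contains
$B \<inter> Z$, so $h(s)$ is as large as possible. Multiplying forms of degree $s$ and $d - s$ shows that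
$h(s) + h(d - s) \<le> |B|$, because the corresponding function spaces are orthogonal for the bilinear
form with weights $c_p$. If $h(d + 1) = |B|$, this says that $h$ grows between the degrees $d - s$
and $d + 1$ at least as much as in the degrees up to $s$. By Macaulay's bound, for points in the
plane the first difference of $h$ does not increase once it fails to be maximal. So the growth in
the intermediate degrees is large as well, and $2 |B| \<ge> (s + 2) (d + 2)$. The assumption that
$h(d + 1) = |B|$ is harmless, since otherwise points can be removed from $B$ one by one
(\<open>annihilated_card_bound\<close>). Together with $|B| \<le> 2 m$ and the choice of $s$, the inequality
contradicts $8 m < d^2 + 2 d$ (\<open>size_bounds_incompatible\<close>).

To compute with $h$, a line missing $B$ is moved to infinity. Then $B$ is a finite set in the affine
plane and $h(i)$ is the dimension of the restrictions to $B$ of polynomials of degree at most $i$.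
A monomial is called fresh if its restriction is not a combination of those of smaller monomials
in the degree-lexicographic order. Fresh monomials provide a basis of the function spaces, and the
others form an ideal, from which Macaulay's bound can be read off (\<open>fresh_in_degree_step\<close>).\<close>

section \<open>Finite families of coordinate vectors\<close>

lemma sum_fun_apply: "(\<Sum>i\<in>I. f i) x = (\<Sum>i\<in>I. f i x)"
  for f :: "'a \<Rightarrow> 'b \<Rightarrow> complex"
  by (induction I rule: infinite_finite_induct) auto

lemma lincomb_apply: "(\<Sum>i\<in>I. cscale (c i) (f i)) x = (\<Sum>i\<in>I. c i * f i x)"
  by (simp add: sum_fun_apply cscale_def)

lemma in_span_image_iff:
  assumes "finite I"
  shows "v \<in> cvec.span (f ` I) \<longleftrightarrow> (\<exists>c. v = (\<Sum>i\<in>I. cscale (c i) (f i)))"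
proof
  assume "v \<in> cvec.span (f ` I)"
  then show "\<exists>c. v = (\<Sum>i\<in>I. cscale (c i) (f i))"
  proof (induction rule: cvec.span_induct_alt)
    case base
    show ?case by (intro exI[of _ "\<lambda>_. 0"]) simp
  next
    case (step a w y)
    then obtain i c where i: "i \<in> I" "w = f i" and y: "y = (\<Sum>i\<in>I. cscale (c i) (f i))" by auto
    have "cscale a w + y = (\<Sum>j\<in>I. cscale (c j + (if j = i then a else 0)) (f j))"
    proof
      fix x
      have "(\<Sum>j\<in>I. (c j + (if j = i then a else 0)) * f j x) = (\<Sum>j\<in>I. c j * f j x) + (\<Sum>j\<in>I. if j = i then a * f i x else 0)"
        unfolding sum.distrib[symmetric] by (intro sum.cong) (auto simp: algebra_simps)
      then show "(cscale a w + y) x = (\<Sum>j\<in>I. cscale (c j + (if j = i then a else 0)) (f j)) x"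
        unfolding lincomb_apply using assms i by (simp add: y lincomb_apply cscale_def[of a])
    qed
    then show ?case by (rule exI[of _ "\<lambda>j. c j + (if j = i then a else 0)"])
  qed
next
  assume "\<exists>c. v = (\<Sum>i\<in>I. cscale (c i) (f i))"
  then show "v \<in> cvec.span (f ` I)"
    by (force intro: cvec.span_sum cvec.span_scale cvec.span_base)
qed

text \<open>The relation is between the members of the indexed family, not between the vectors of its image:
two indices with the same value already give one.\<close>

lemma exists_linear_relation:
  assumes "finite I" "finite T" "f ` I \<subseteq> cvec.span T" "card T < card I"
  shows "\<exists>c. (\<exists>i\<in>I. c i \<noteq> 0) \<and> (\<Sum>i\<in>I. cscale (c i) (f i)) = 0"
proof (cases "inj_on f I")
  case True
  have "cvec.dependent (f ` I)"
    using cvec.independent_span_bound[OF assms(2) _ assms(3)] card_image[OF True] assms(4) by auto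
  then obtain u where u: "\<exists>v\<in>f ` I. u v \<noteq> 0" "(\<Sum>v\<in>f ` I. cscale (u v) v) = 0"
    using cvec.dependent_finite[of "f ` I"] assms(1) by auto
  then show ?thesis
    using True by (intro exI[of _ "u \<circ> f"]) (auto simp: sum.reindex)
next
  case False
  then obtain i j where ij: "i \<in> I" "j \<in> I" "i \<noteq> j" "f i = f j" by (auto simp: inj_on_def)
  define c :: "'a \<Rightarrow> complex" where "c = (\<lambda>m. if m = i then 1 else if m = j then - 1 else 0)"
  have "(\<Sum>m\<in>I. cscale (c m) (f m)) = (\<Sum>m\<in>{i, j}. cscale (c m) (f m))"
    using ij assms(1) by (intro sum.mono_neutral_right) (auto simp: c_def)
  also have "\<dots> = 0"
    using ij by (auto simp: c_def fun_eq_iff cscale_def)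
  finally show ?thesis
    using ij by (intro exI[of _ c]) (auto simp: c_def)
qed

lemma coord_space_spanning:
  assumes "finite B"
  obtains T where "finite T" "card T \<le> card B" "coord_space B \<subseteq> cvec.span T"
proof
  let ?e = "\<lambda>p q. if q = p then 1 else (0::complex)"
  show "finite (?e ` B)" "card (?e ` B) \<le> card B"
    using assms by (auto intro: card_image_le)
  show "coord_space B \<subseteq> cvec.span (?e ` B)"
  proof
    fix v assume v: "v \<in> coord_space B"
    have "v = (\<Sum>p\<in>B. cscale (v p) (?e p))"
    proof
      fix q
      show "v q = (\<Sum>p\<in>B. cscale (v p) (?e p)) q"
        unfolding lincomb_apply using v assms by (auto simp: coord_space_def if_distrib cong: if_cong)
    qed
    then show "v \<in> cvec.span (?e ` B)"
      using in_span_image_iff[OF assms] by blast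
  qed
qed

lemma independent_in_coord_space:
  assumes "finite B" "cvec.independent U" "U \<subseteq> coord_space B"
  shows "finite U \<and> card U \<le> card B"
proof -
  obtain T where T: "finite T" "card T \<le> card B" "coord_space B \<subseteq> cvec.span T"
    by (rule coord_space_spanning[OF assms(1)])
  have "U \<subseteq> cvec.span T" using assms(3) T(3) by blast
  then show ?thesis using cvec.independent_span_bound[OF T(1) assms(2)] T(2) by (meson le_trans)
qed

text \<open>A homogeneous linear system with fewer equations than unknowns has a nonzero solution: the
columns of the system, one for each \<^term>\<open>p \<in> B\<close>, lie in a space of dimension at most
\<^term>\<open>card U\<close>.\<close>

lemma exists_orthogonal_vector:
  fixes U :: "('i \<Rightarrow> complex) set"
  assumes "finite B" "finite U" "card U < card B"
  shows "\<exists>c. (\<exists>p\<in>B. c p \<noteq> 0) \<and> (\<forall>u\<in>U. (\<Sum>p\<in>B. c p * u p) = 0)"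
proof -
  let ?r = "\<lambda>p u. if u \<in> U then u p else (0::complex)"
  obtain T where T: "finite T" "card T \<le> card U" "coord_space U \<subseteq> cvec.span T"
    by (rule coord_space_spanning[OF assms(2)])
  have "?r ` B \<subseteq> coord_space U" by (auto simp: coord_space_def)
  then obtain c where c: "\<exists>p\<in>B. c p \<noteq> 0" "(\<Sum>p\<in>B. cscale (c p) (?r p)) = 0"
    using exists_linear_relation[of B T ?r] assms T by (meson le_less_trans order_trans)
  have "(\<Sum>p\<in>B. c p * u p) = 0" if "u \<in> U" for u
    using fun_cong[OF c(2), of u] that unfolding lincomb_apply by simp
  with c show ?thesis by blast
qed

text \<open>The diagonal bilinear form with entries \<^term>\<open>c\<close> is nondegenerate on \<^term>\<open>coord_space B\<close>, so
the dimensions of two orthogonal subspaces add up to at most that of the whole space. For the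
proof, \<^term>\<open>V\<close> is extended to a basis. If there were more vectors in \<^term>\<open>U\<close> than new basis
vectors, some nontrivial combination of \<^term>\<open>U\<close> would pair to zero with the whole basis and
would therefore vanish.\<close>

lemma orthogonal_card_le:
  fixes c :: "'i \<Rightarrow> complex"
  assumes B: "finite B" "\<And>p. p \<in> B \<Longrightarrow> c p \<noteq> 0"
    and U: "cvec.independent U" "U \<subseteq> coord_space B"
    and V: "cvec.independent V" "V \<subseteq> coord_space B"
    and orth: "\<And>u v. u \<in> U \<Longrightarrow> v \<in> V \<Longrightarrow> (\<Sum>p\<in>B. c p * u p * v p) = 0"
  shows "card U + card V \<le> card B"
proof (rule ccontr)
  assume less: "\<not> card U + card V \<le> card B"
  obtain W where W: "V \<subseteq> W" "W \<subseteq> coord_space B" "cvec.independent W" "coord_space B \<subseteq> cvec.span W"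
    using cvec.maximal_independent_subset_extend[OF V(2,1)] by blast
  have fin: "finite U" "finite W" "card W \<le> card B"
    using independent_in_coord_space[OF B(1)] U W by auto
  define D where "D = W - V"
  have D: "finite D" "card D < card U"
    using fin W(1) less card_mono[OF fin(2) W(1)] card_Diff_subset[of V W] finite_subset[OF W(1)] unfolding D_def by auto
  define r where "r = (\<lambda>u v. if v \<in> D then (\<Sum>p\<in>B. c p * u p * v p) else 0)"
  obtain T where T: "finite T" "card T \<le> card D" "coord_space D \<subseteq> cvec.span T"
    by (rule coord_space_spanning[OF D(1)])
  have "r ` U \<subseteq> coord_space D" by (auto simp: coord_space_def r_def)
  then obtain a where a: "\<exists>u\<in>U. a u \<noteq> 0" "(\<Sum>u\<in>U. cscale (a u) (r u)) = 0"
    using exists_linear_relation[OF fin(1) T(1), of r] T D by (meson le_less_trans order_trans)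
  define w where "w = (\<Sum>u\<in>U. cscale (a u) u)"
  have pair: "(\<Sum>p\<in>B. c p * w p * v p) = (\<Sum>u\<in>U. a u * (\<Sum>p\<in>B. c p * u p * v p))" for v
    unfolding w_def lincomb_apply sum_distrib_left sum_distrib_right
    by (subst sum.swap) (simp add: mult_ac)
  have zero: "(\<Sum>p\<in>B. c p * w p * v p) = 0" if "v \<in> W" for v
  proof (cases "v \<in> V")
    case True
    then show ?thesis using orth by (simp add: pair)
  next
    case False
    then have "v \<in> D" using that by (simp add: D_def)
    then show ?thesis
      using fun_cong[OF a(2), of v] unfolding lincomb_apply by (simp add: pair r_def)
  qed
  have zero': "(\<Sum>p\<in>B. c p * w p * v p) = 0" if "v \<in> cvec.span W" for v
    using that
  proof (induction rule: cvec.span_induct_alt)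
    case (step b x y)
    have "(\<Sum>p\<in>B. c p * w p * (cscale b x + y) p) =
        b * (\<Sum>p\<in>B. c p * w p * x p) + (\<Sum>p\<in>B. c p * w p * y p)"
      by (simp add: cscale_def algebra_simps sum.distrib sum_distrib_left)
    then show ?case using step zero by simp
  qed simp
  have "w p = 0" for p
  proof (cases "p \<in> B")
    case True
    let ?e = "\<lambda>q. if q = p then 1 else (0::complex)"
    have "?e \<in> coord_space B" using True by (auto simp: coord_space_def)
    then have "(\<Sum>q\<in>B. c q * w q * ?e q) = 0" using zero' W(4) by blast
    then show ?thesis using True B by (simp add: if_distrib cong: if_cong)
  next
    case False
    then show ?thesis
      using U(2) unfolding w_def lincomb_apply by (intro sum.neutral) (auto simp: coord_space_def)
  qed
  then have "w = 0" by auto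
  then show False
    using a(1) U(1) cvec.dependent_finite[OF fin(1)] unfolding w_def by blast
qed

section \<open>The basis chosen greedily from a sequence of vectors\<close>

definition fresh :: "(nat \<Rightarrow> 'i \<Rightarrow> complex) \<Rightarrow> nat \<Rightarrow> bool" where
  "fresh \<mu> n \<longleftrightarrow> \<mu> n \<notin> cvec.span (\<mu> ` {..<n})"

lemma fresh_basis:
  "inj_on \<mu> {n. n < N \<and> fresh \<mu> n} \<and> cvec.independent (\<mu> ` {n. n < N \<and> fresh \<mu> n}) \<and>
   cvec.span (\<mu> ` {n. n < N \<and> fresh \<mu> n}) = cvec.span (\<mu> ` {..<N})"
proof (induction N)
  case 0
  show ?case by (simp add: cvec.independent_empty)
next
  case (Suc N)
  let ?M = "\<lambda>N. {n. n < N \<and> fresh \<mu> n}"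
  show ?case
  proof (cases "fresh \<mu> N")
    case True
    then have notin: "\<mu> N \<notin> cvec.span (\<mu> ` ?M N)" using Suc by (simp add: fresh_def)
    have "?M (Suc N) = insert N (?M N)" using True by (auto simp: less_Suc_eq)
    then show ?thesis
      using Suc notin cvec.span_base[of "\<mu> N" "\<mu> ` ?M N"] cvec.independent_insertI[OF notin]
      by (auto simp: lessThan_Suc cvec.span_insert)
  next
    case False
    then have "?M (Suc N) = ?M N" by (auto simp: less_Suc_eq)
    then show ?thesis
      using Suc False by (auto simp: lessThan_Suc fresh_def cvec.span_redundant)
  qed
qed

lemma card_fresh: "card (\<mu> ` {n. n < N \<and> fresh \<mu> n}) = card {n. n < N \<and> fresh \<mu> n}"
  using fresh_basis by (blast intro: card_image)

section \<open>The Hilbert function of a finite set in the affine plane\<close>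

lemma triangle_mono: "m \<le> n \<Longrightarrow> triangle m \<le> triangle n"
  by (rule lift_Suc_mono_le[of triangle]) auto

text \<open>The Cantor enumeration \<^const>\<open>prod_encode\<close> is the degree-lexicographic order on the monomials
$x^a y^b$: the indices below \<^term>\<open>triangle (Suc i)\<close> are those of the monomials of degree at
most $i$.\<close>

lemma prod_encode_less_triangle: "prod_encode (a, b) < triangle (Suc i) \<longleftrightarrow> a + b \<le> i"
proof
  assume "a + b \<le> i"
  then show "prod_encode (a, b) < triangle (Suc i)"
    using triangle_mono[of "Suc (a + b)" "Suc i"] by (simp add: prod_encode_def)
next
  assume less: "prod_encode (a, b) < triangle (Suc i)"
  show "a + b \<le> i"
  proof (rule ccontr)
    assume "\<not> a + b \<le> i"
    then have "triangle (Suc i) \<le> triangle (a + b)" by (intro triangle_mono) simp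
    with less show False by (simp add: prod_encode_def)
  qed
qed

text \<open>The restriction of the \<^term>\<open>n\<close>-th monomial to the points of \<^term>\<open>B\<close>, extended by zero so that
it is a vector of \<^term>\<open>coord_space B\<close>.\<close>

definition monom_on :: "(complex \<times> complex) set \<Rightarrow> nat \<Rightarrow> complex \<times> complex \<Rightarrow> complex" where
  "monom_on B n = (\<lambda>p. if p \<in> B then fst p ^ fst (prod_decode n) * snd p ^ snd (prod_decode n) else 0)"

lemma monom_on_in_coord_space: "monom_on B n \<in> coord_space B"
  by (simp add: monom_on_def coord_space_def)

lemma prod_encode_less_degree_mono:
  assumes "prod_encode (a', b') < prod_encode (a, b)"
  shows "a' + b' \<le> a + b"
  using assms prod_encode_less_triangle[of a b "a + b"] prod_encode_less_triangle[of a' b' "a + b"]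
  by auto

text \<open>The monomials that are not fresh form a monomial ideal, since multiplication by a coordinate
preserves the degree-lexicographic order. The parameter \<^term>\<open>i\<close> selects the coordinate: the
factor is the first one for \<^term>\<open>i = 1\<close> and the second one for \<^term>\<open>i = 0\<close>.\<close>

lemma not_fresh_times_coordinate:
  assumes "\<not> fresh (monom_on B) (prod_encode (a, b))" and "i \<le> 1"
  shows "\<not> fresh (monom_on B) (prod_encode (a + i, b + (1 - i)))"
proof -
  define T where "T = (\<lambda>v p. fst p ^ i * snd p ^ (1 - i) * (v p :: complex))"
  have T_monom: "T (monom_on B (prod_encode (a', b'))) = monom_on B (prod_encode (a' + i, b' + (1 - i)))" for a' b'
    by (auto simp: T_def monom_on_def power_add mult_ac fun_eq_iff)
  have "T v \<in> cvec.span (monom_on B ` {..<prod_encode (a + i, b + (1 - i))})"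
    if "v \<in> cvec.span (monom_on B ` {..<prod_encode (a, b)})" for v
    using that
  proof (induction rule: cvec.span_induct_alt)
    case base
    have "T 0 = 0" by (simp add: T_def fun_eq_iff)
    then show ?case using cvec.span_zero by metis
  next
    case (step c w y)
    then obtain m where m: "m < prod_encode (a, b)" "w = monom_on B m" by auto
    obtain a' b' where ab': "m = prod_encode (a', b')" by (metis prod_decode_inverse surj_pair)
    have "prod_encode (a' + i, b' + (1 - i)) < prod_encode (a + i, b + (1 - i))"
      using m(1) prod_encode_less_degree_mono[of a' b' a b] assms(2) unfolding ab'
      by (cases i) (auto simp: prod_encode_def)
    then have "T w \<in> cvec.span (monom_on B ` {..<prod_encode (a + i, b + (1 - i))})"
      unfolding m(2) ab' T_monom by (intro cvec.span_base) auto
    moreover have "T (cscale c w + y) = cscale c (T w) + T y"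
      by (simp add: T_def fun_eq_iff cscale_def algebra_simps)
    ultimately show ?case using step.IH cvec.span_add cvec.span_scale by metis
  qed
  then show ?thesis using assms(1) unfolding fresh_def T_monom[symmetric] by blast
qed

text \<open>The fresh monomials of degree at most $i$ restrict to a basis of the functions on \<^term>\<open>B\<close> given by
polynomials of degree at most $i$, so this number is the first difference of the Hilbert function
of \<^term>\<open>B\<close>.\<close>

definition fresh_in_degree :: "(complex \<times> complex) set \<Rightarrow> nat \<Rightarrow> nat" where
  "fresh_in_degree B i = card {a. a \<le> i \<and> fresh (monom_on B) (prod_encode (a, i - a))}"

lemma card_fresh_below_triangle:
  "card {n. n < triangle i \<and> fresh (monom_on B) n} = (\<Sum>j<i. fresh_in_degree B j)"
proof (induction i)
  case (Suc i)
  let ?A = "{n. n < triangle i \<and> fresh (monom_on B) n}"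
  let ?D = "{a. a \<le> i \<and> fresh (monom_on B) (prod_encode (a, i - a))}"
  let ?g = "\<lambda>a. prod_encode (a, i - a)"
  have g: "?g a = triangle i + a" if "a \<le> i" for a using that by (simp add: prod_encode_def)
  have split: "{n. n < triangle (Suc i) \<and> fresh (monom_on B) n} = ?A \<union> ?g ` ?D"
  proof (intro set_eqI iffI)
    fix n assume n: "n \<in> {n. n < triangle (Suc i) \<and> fresh (monom_on B) n}"
    show "n \<in> ?A \<union> ?g ` ?D"
    proof (cases "n < triangle i")
      case False
      then have "n - triangle i \<le> i" "n = ?g (n - triangle i)" using n g[of "n - triangle i"] by auto
      then show ?thesis using n by (metis (mono_tags, lifting) UnI2 image_eqI mem_Collect_eq)
    qed (use n in auto)
  next
    fix n assume "n \<in> ?A \<union> ?g ` ?D"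
    then show "n \<in> {n. n < triangle (Suc i) \<and> fresh (monom_on B) n}"
      using g by auto
  qed
  have "?A \<inter> ?g ` ?D = {}" using g by auto
  moreover have "inj_on ?g ?D" by (auto intro: inj_onI)
  ultimately show ?case
    unfolding split by (subst card_Un_disjoint) (auto simp: card_image Suc fresh_in_degree_def)
qed simp

lemma card_shift_union:
  fixes N :: "nat set"
  assumes "finite N" "N \<noteq> {}"
  shows "Suc (card N) \<le> card (N \<union> Suc ` N)"
proof -
  have "Suc (Max N) \<notin> N" using Max_ge[OF assms(1), of "Suc (Max N)"] by auto
  then have "Suc (card N) = card (insert (Suc (Max N)) N)" using assms by simp
  also have "\<dots> \<le> card (N \<union> Suc ` N)"
    using assms by (intro card_mono) (auto intro: Max_in)
  finally show ?thesis .
qed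

text \<open>Macaulay's bound in two variables. If some monomials $x^a y^{i-a}$ are not fresh, then
their multiples in the next degree are not fresh either, and there is at least one more of these.
The next degree has exactly one more monomial in total, so the number of fresh ones cannot grow.\<close>

lemma fresh_in_degree_step:
  "fresh_in_degree B i = Suc i \<or> fresh_in_degree B (Suc i) \<le> fresh_in_degree B i"
proof -
  let ?P = "\<lambda>i a. fresh (monom_on B) (prod_encode (a, i - a))"
  define N where "N = (\<lambda>i. {a. a \<le> i \<and> \<not> ?P i a})"
  have count: "fresh_in_degree B i = Suc i - card (N i)" and card_N: "card (N i) \<le> Suc i" for i
  proof -
    have "{a. a \<le> i \<and> ?P i a} = {..i} - N i" by (auto simp: N_def)
    moreover have "finite (N i)" "N i \<subseteq> {..i}" by (auto simp: N_def)
    ultimately show "fresh_in_degree B i = Suc i - card (N i)"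
      by (simp add: fresh_in_degree_def card_Diff_subset)
    show "card (N i) \<le> Suc i" using card_mono[of "{..i}" "N i"] by (auto simp: N_def)
  qed
  have "N i \<union> Suc ` N i \<subseteq> N (Suc i)"
  proof -
    have "a \<in> N (Suc i)" "Suc a \<in> N (Suc i)" if "a \<in> N i" for a
      using that not_fresh_times_coordinate[of B a "i - a" 0] not_fresh_times_coordinate[of B a "i - a" 1]
      by (auto simp: N_def Suc_diff_le)
    then show ?thesis by auto
  qed
  moreover have fin: "finite (N i)" for i by (auto simp: N_def)
  ultimately have "N i = {} \<or> Suc (card (N i)) \<le> card (N (Suc i))"
    using card_shift_union[OF fin] card_mono[OF fin] le_trans by metis
  then show ?thesis using count[of i] count[of "Suc i"] by auto
qed

text \<open>A count below $(s + 2) / 2$ in a degree $i \<ge> s$ is smaller than the number $i + 1$ of all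
monomials of that degree, so from there on the counts can only decrease.\<close>

lemma fresh_in_degree_stays_small:
  assumes "2 * fresh_in_degree B i < s + 2" "s \<le> i" "i \<le> j"
  shows "fresh_in_degree B j \<le> fresh_in_degree B i"
  using assms(3)
proof (induction rule: dec_induct)
  case (step n)
  then show ?case using fresh_in_degree_step[of B n] assms by auto
qed simp

lemma double_triangle: "2 * triangle n = n * Suc n"
  by (induction n) auto

text \<open>Write $h$ for the Hilbert function and $\<Delta>$ for its first difference, \<^const>\<open>fresh_in_degree\<close>.
The hypotheses \<open>sym\<close> and \<open>top\<close> force the $s + 1$ highest degrees $d - s + 1, \<dots>, d + 1$ to
contribute at least $h(s) = (s + 1) (s + 2) / 2$, that is, $(s + 2) / 2$ on average. As $\<Delta>$ does
not increase again once it is small, every degree from $s + 1$ to $d - s$ contributes at least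
$(s + 2) / 2$ too. Adding the three ranges of degrees gives the bound.\<close>

lemma card_bound_of_degree_counts:
  assumes "2 * s < d"
    and full: "\<And>i. i \<le> s \<Longrightarrow> fresh_in_degree B i = Suc i"
    and sym: "(\<Sum>j<Suc s. fresh_in_degree B j) + (\<Sum>j<Suc (d - s). fresh_in_degree B j) \<le> K"
    and top: "K \<le> (\<Sum>j<d + 2. fresh_in_degree B j)"
  shows "(s + 2) * (d + 2) \<le> 2 * K"
proof -
  let ?D = "fresh_in_degree B"
  have low: "(\<Sum>j<Suc s. ?D j) = triangle (Suc s)"
  proof -
    have "(\<Sum>j<Suc s. ?D j) = (\<Sum>j<Suc s. Suc j)" using full by (intro sum.cong) auto
    also have "(\<Sum>j<n. Suc j) = triangle n" for n by (induction n) auto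
    finally show ?thesis .
  qed
  have split: "(\<Sum>j<d + 2. ?D j) = (\<Sum>j<Suc (d - s). ?D j) + (\<Sum>j\<in>{Suc (d - s)..<d + 2}. ?D j)"
    using sum.atLeastLessThan_concat[of 0 "Suc (d - s)" "d + 2" ?D] by (simp add: lessThan_atLeast0)
  have last: "s + 2 \<le> 2 * ?D (d - s)"
  proof (rule ccontr)
    assume "\<not> ?thesis"
    then have small: "2 * ?D (d - s) < s + 2" by simp
    have "(\<Sum>j\<in>{Suc (d - s)..<d + 2}. ?D j) \<le> (\<Sum>j\<in>{Suc (d - s)..<d + 2}. ?D (d - s))"
      using assms(1) by (intro sum_mono fresh_in_degree_stays_small[OF small]) auto
    also have "\<dots> = Suc s * ?D (d - s)" using assms(1) by simp
    finally have "triangle (Suc s) \<le> Suc s * ?D (d - s)" using sym top split low by linarith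
    then have "Suc s * (s + 2) \<le> Suc s * (2 * ?D (d - s))" using double_triangle[of "Suc s"] by simp
    then show False using small by (simp only: mult_le_cancel1) simp
  qed
  have mid: "s + 2 \<le> 2 * ?D j" if "j \<in> {Suc s..<Suc (d - s)}" for j
    using last fresh_in_degree_stays_small[of B j s "d - s"] that by fastforce
  have "Suc (d - s) - Suc s = d - 2 * s" by simp
  then have "(d - 2 * s) * (s + 2) = (\<Sum>j\<in>{Suc s..<Suc (d - s)}. s + 2)"
    by (simp only: sum_constant card_atLeastLessThan of_nat_id)
  also have "\<dots> \<le> (\<Sum>j\<in>{Suc s..<Suc (d - s)}. 2 * ?D j)" by (intro sum_mono mid)
  also have "\<dots> = 2 * (\<Sum>j\<in>{Suc s..<Suc (d - s)}. ?D j)" by (simp add: sum_distrib_left)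
  finally have "(d - 2 * s) * (s + 2) \<le> 2 * (\<Sum>j\<in>{Suc s..<Suc (d - s)}. ?D j)" .
  moreover have "(\<Sum>j<Suc (d - s). ?D j) = triangle (Suc s) + (\<Sum>j\<in>{Suc s..<Suc (d - s)}. ?D j)"
    using sum.atLeastLessThan_concat[of 0 "Suc s" "Suc (d - s)" ?D] assms(1) low
    by (simp add: lessThan_atLeast0)
  ultimately have "2 * Suc s * (s + 2) + (d - 2 * s) * (s + 2) \<le> 2 * K"
    using sym low double_triangle[of "Suc s"] by simp
  moreover obtain e where "d = 2 * s + e" using assms(1) by (metis less_imp_add_positive)
  ultimately show ?thesis by (simp add: algebra_simps)
qed

section \<open>Relations between evaluations at points\<close>

definition annihilates :: "(complex \<times> complex \<Rightarrow> complex) \<Rightarrow> (complex \<times> complex) set \<Rightarrow> nat \<Rightarrow> bool" where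
  "annihilates c B d \<longleftrightarrow> (\<forall>a b. a + b \<le> d \<longrightarrow> (\<Sum>p\<in>B. c p * (fst p ^ a * snd p ^ b)) = 0)"

text \<open>Points on the conic $(1 : t : t^2)$ are general enough to avoid finitely many linear conditions.
This gives a line missing finitely many points of the projective plane, and an affine function
whose values avoid finitely many prescribed ones.\<close>

lemma exists_common_non_root:
  fixes f :: "'i \<Rightarrow> complex \<times> complex \<times> complex"
  assumes "finite I" "\<And>i. i \<in> I \<Longrightarrow> f i \<noteq> (0, 0, 0)"
  obtains t where "\<And>i. i \<in> I \<Longrightarrow> fst (f i) + t * fst (snd (f i)) + t\<^sup>2 * snd (snd (f i)) \<noteq> 0"
proof -
  have fin: "finite {t. a + t * b + t\<^sup>2 * c = 0}" if nz: "(a, b, c) \<noteq> (0, 0, 0)" for a b c :: complex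
  proof -
    let ?c = "\<lambda>i::nat. if i = 0 then a else if i = 1 then b else c"
    have "finite {t. (\<Sum>i\<le>2. ?c i * t ^ i) = 0}"
      unfolding polyfun_finite_roots
    proof -
      from nz consider "a \<noteq> 0" | "b \<noteq> 0" | "c \<noteq> 0" by auto
      then show "\<exists>i\<le>2. ?c i \<noteq> 0"
        by cases (rule exI[of _ 0], simp, rule exI[of _ 1], simp, rule exI[of _ 2], simp)
    qed
    then show ?thesis by (simp add: numeral_2_eq_2 mult_ac add_ac)
  qed
  have "finite (\<Union>i\<in>I. {t. fst (f i) + t * fst (snd (f i)) + t\<^sup>2 * snd (snd (f i)) = 0})"
    using assms by (intro finite_UN_I fin) (auto simp: prod_eq_iff)
  then obtain t where "t \<notin> (\<Union>i\<in>I. {t. fst (f i) + t * fst (snd (f i)) + t\<^sup>2 * snd (snd (f i)) = 0})"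
    using ex_new_if_finite[OF infinite_UNIV_char_0] by blast
  then show ?thesis using that by blast
qed

text \<open>The product of an affine function $l$ with the relation \<^term>\<open>c'\<close> annihilates degree
\<^term>\<open>d\<close>, so \<^term>\<open>c\<close> may be changed by it. The value of $l$ at \<^term>\<open>p\<close> is prescribed so that
the coefficient there cancels; as the other points differ from \<^term>\<open>p\<close>, a general such $l$ cancels
no other coefficient.\<close>

lemma drop_point:
  assumes B: "finite B" "p \<in> B"
    and c: "\<And>q. q \<in> B \<Longrightarrow> c q \<noteq> 0" "annihilates c B d"
    and c': "c' p \<noteq> 0" "annihilates c' B (Suc d)"
  obtains c'' where "\<And>q. q \<in> B - {p} \<Longrightarrow> c'' q \<noteq> 0" "annihilates c'' (B - {p}) d"
proof -
  define f where "f = (\<lambda>q. (c q / c' q - c p / c' p, fst q - fst p, snd q - snd p))"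
  have "f q \<noteq> (0, 0, 0)" if "q \<in> B - {p}" for q
    using that by (auto simp: f_def prod_eq_iff)
  then obtain t where t: "\<And>q. q \<in> B - {p} \<Longrightarrow>
      fst (f q) + t * fst (snd (f q)) + t\<^sup>2 * snd (snd (f q)) \<noteq> 0"
    using exists_common_non_root[of "B - {p}" f] B by auto
  define l where "l = (\<lambda>q. - (c p / c' p) + t * (fst q - fst p) + t\<^sup>2 * (snd q - snd p))"
  define c'' where "c'' = (\<lambda>q. c q + l q * c' q)"
  have nz: "c'' q \<noteq> 0" if q: "q \<in> B - {p}" for q
  proof (cases "c' q = 0")
    case True
    then show ?thesis using c(1) q by (simp add: c''_def)
  next
    case False
    then have "c'' q = c' q * (fst (f q) + t * fst (snd (f q)) + t\<^sup>2 * snd (snd (f q)))"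
      by (simp add: c''_def l_def f_def field_simps)
    then show ?thesis using t[OF q] False by simp
  qed
  have "(\<Sum>q\<in>B - {p}. c'' q * (fst q ^ a * snd q ^ b)) = 0" if ab: "a + b \<le> d" for a b
  proof -
    have "c'' p = 0" using c' by (simp add: c''_def l_def)
    then have "(\<Sum>q\<in>B - {p}. c'' q * (fst q ^ a * snd q ^ b)) = (\<Sum>q\<in>B. c'' q * (fst q ^ a * snd q ^ b))"
      using B by (intro sum.mono_neutral_left) auto
    also have "\<dots> = (\<Sum>q\<in>B. c q * (fst q ^ a * snd q ^ b))
        + (- (c p / c' p) - t * fst p - t\<^sup>2 * snd p) * (\<Sum>q\<in>B. c' q * (fst q ^ a * snd q ^ b))
        + t * (\<Sum>q\<in>B. c' q * (fst q ^ Suc a * snd q ^ b))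
        + t\<^sup>2 * (\<Sum>q\<in>B. c' q * (fst q ^ a * snd q ^ Suc b))"
      unfolding sum_distrib_left sum.distrib[symmetric]
      by (intro sum.cong) (auto simp: c''_def l_def algebra_simps)
    also have "\<dots> = 0"
    proof -
      have "(\<Sum>q\<in>B. c q * (fst q ^ a * snd q ^ b)) = 0"
        "(\<Sum>q\<in>B. c' q * (fst q ^ a * snd q ^ b)) = 0"
        "(\<Sum>q\<in>B. c' q * (fst q ^ Suc a * snd q ^ b)) = 0"
        "(\<Sum>q\<in>B. c' q * (fst q ^ a * snd q ^ Suc b)) = 0"
        using c(2) c'(2) ab unfolding annihilates_def by (simp_all del: power_Suc)
      then show ?thesis by (simp only: mult_zero_right add_0)
    qed
    finally show ?thesis .
  qed
  then show ?thesis using nz that unfolding annihilates_def by blast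
qed

lemma annihilates_monom_on:
  assumes "annihilates c B d" "n < triangle (Suc d)"
  shows "(\<Sum>p\<in>B. c p * monom_on B n p) = 0"
proof -
  obtain a b where n: "n = prod_encode (a, b)" by (metis prod_decode_inverse surj_pair)
  then have "a + b \<le> d" using assms(2) prod_encode_less_triangle by blast
  then show ?thesis using assms(1) by (simp add: annihilates_def monom_on_def n cong: sum.cong)
qed

lemma annihilates_monom_on_iff:
  "annihilates c B d \<longleftrightarrow> (\<forall>n<triangle (Suc d). (\<Sum>p\<in>B. c p * monom_on B n p) = 0)"
proof
  assume *: "\<forall>n<triangle (Suc d). (\<Sum>p\<in>B. c p * monom_on B n p) = 0"
  show "annihilates c B d"
    unfolding annihilates_def
  proof (intro allI impI)
    fix a b assume "a + b \<le> d"
    then have "(\<Sum>p\<in>B. c p * monom_on B (prod_encode (a, b)) p) = 0"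
      using * prod_encode_less_triangle by blast
    then show "(\<Sum>p\<in>B. c p * (fst p ^ a * snd p ^ b)) = 0"
      by (simp add: monom_on_def cong: sum.cong)
  qed
qed (use annihilates_monom_on in blast)

lemma annihilates_product:
  assumes c: "annihilates c B (i + j)" and m: "m < triangle (Suc i)" and n: "n < triangle (Suc j)"
  shows "(\<Sum>p\<in>B. c p * monom_on B m p * monom_on B n p) = 0"
proof -
  obtain a b where ab: "m = prod_encode (a, b)" by (metis prod_decode_inverse surj_pair)
  obtain a' b' where ab': "n = prod_encode (a', b')" by (metis prod_decode_inverse surj_pair)
  have "a + a' + (b + b') \<le> i + j"
    using m n prod_encode_less_triangle unfolding ab ab' by (metis add.assoc add.left_commute add_mono)
  then have "(\<Sum>p\<in>B. c p * (fst p ^ (a + a') * snd p ^ (b + b'))) = 0"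
    using c unfolding annihilates_def by blast
  then show ?thesis by (simp add: ab ab' monom_on_def power_add mult_ac cong: sum.cong)
qed

text \<open>A bound of Cayley-Bacharach type. Polynomials of degree at most $s$, multiplied pointwise by
\<^term>\<open>c\<close>, are orthogonal to those of degree at most $d - s$; hence $h(s) + h(d - s) \<le> |B|$. To
conclude with the symmetry estimate, the Hilbert function must reach $|B|$ by degree $d + 1$. If it
does not, there is a nonzero relation annihilating degree $d + 1$, and it can be used to remove a
point from \<^term>\<open>B\<close>. This does not spoil the hypothesis on degree $s$: the same
relation forces a polynomial of degree at most $s$ that vanishes on the remaining points to vanish
at the removed one as well.\<close>

lemma annihilated_card_bound:
  assumes "finite B" "\<And>p. p \<in> B \<Longrightarrow> c p \<noteq> 0" "annihilates c B d" "2 * s < d"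
    and "\<And>n. n < triangle (Suc s) \<Longrightarrow> fresh (monom_on B) n"
  shows "(s + 2) * (d + 2) \<le> 2 * card B"
  using assms(1-3,5)
proof (induction "card B" arbitrary: B c rule: less_induct)
  case less
  note fin = less.prems(1) and c = less.prems(2,3) and full = less.prems(4)
  let ?F = "\<lambda>i. monom_on B ` {n. n < triangle i \<and> fresh (monom_on B) n}"
  have F: "cvec.independent (?F i)" "?F i \<subseteq> coord_space B" "finite (?F i)"
    "cvec.span (?F i) = cvec.span (monom_on B ` {..<triangle i})"
    "card (?F i) = (\<Sum>j<i. fresh_in_degree B j)" for i
    using fresh_basis[of "monom_on B" "triangle i"] card_fresh[of "monom_on B" "triangle i"]
    by (auto simp: monom_on_in_coord_space card_fresh_below_triangle)
  show ?case
  proof (cases "\<exists>c' p. p \<in> B \<and> c' p \<noteq> 0 \<and> annihilates c' B (Suc d)")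
    case True
    then obtain c' p where p: "p \<in> B" "c' p \<noteq> 0" "annihilates c' B (Suc d)" by blast
    obtain c'' where c'': "\<And>q. q \<in> B - {p} \<Longrightarrow> c'' q \<noteq> 0" "annihilates c'' (B - {p}) d"
      using drop_point[OF fin p(1) c p(2,3)] by blast
    have "fresh (monom_on (B - {p})) n" if n: "n < triangle (Suc s)" for n
    proof (rule ccontr)
      assume "\<not> ?thesis"
      then obtain a where a: "monom_on (B - {p}) n = (\<Sum>m<n. cscale (a m) (monom_on (B - {p}) m))"
        unfolding fresh_def by (auto simp: in_span_image_iff)
      \<comment> \<open>The polynomial \<^term>\<open>g\<close> has degree at most $s$ and vanishes outside \<^term>\<open>p\<close>.\<close>
      define g where "g = (\<lambda>q. monom_on B n q - (\<Sum>m<n. a m * monom_on B m q))"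
      have g_off: "g q = 0" if "q \<noteq> p" for q
      proof -
        have "monom_on (B - {p}) m q = monom_on B m q" for m using that by (simp add: monom_on_def)
        then show ?thesis using fun_cong[OF a, of q] unfolding lincomb_apply by (simp add: g_def)
      qed
      have "(\<Sum>q\<in>B. c' q * g q) = (\<Sum>q\<in>B. c' q * monom_on B n q) - (\<Sum>m<n. a m * (\<Sum>q\<in>B. c' q * monom_on B m q))"
      proof -
        have "(\<Sum>q\<in>B. c' q * (\<Sum>m<n. a m * monom_on B m q)) = (\<Sum>m<n. a m * (\<Sum>q\<in>B. c' q * monom_on B m q))"
          unfolding sum_distrib_left by (subst sum.swap) (simp add: mult_ac)
        then show ?thesis by (simp add: g_def right_diff_distrib sum_subtractf)
      qed
      also have "\<dots> = 0"
      proof -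
        have "triangle (Suc s) \<le> triangle (Suc (Suc d))" using assms(4) by (intro triangle_mono) simp
        then show ?thesis using annihilates_monom_on[OF p(3)] n by simp
      qed
      finally have "(\<Sum>q\<in>B. c' q * g q) = 0" .
      moreover have "(\<Sum>q\<in>B. c' q * g q) = (\<Sum>q\<in>{p}. c' q * g q)"
        using fin p(1) g_off by (intro sum.mono_neutral_right) auto
      ultimately have "g p = 0" using p(2) by simp
      then have "g q = 0" for q using g_off by (cases "q = p") auto
      then have "monom_on B n = (\<Sum>m<n. cscale (a m) (monom_on B m))"
        by (auto simp: fun_eq_iff lincomb_apply g_def)
      then show False using full[OF n] unfolding fresh_def by (auto simp: in_span_image_iff)
    qed
    moreover have "card (B - {p}) < card B" using fin p(1) by (rule card_Diff1_less)
    ultimately have "(s + 2) * (d + 2) \<le> 2 * card (B - {p})"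
      using less.hyps[of "B - {p}" c''] fin c'' by blast
    then show ?thesis using \<open>card (B - {p}) < card B\<close> by linarith
  next
    case False
    have "card B \<le> card (?F (d + 2))"
    proof (rule ccontr)
      assume "\<not> ?thesis"
      then have "card (?F (d + 2)) < card B" by simp
      then obtain c' where c': "\<exists>p\<in>B. c' p \<noteq> 0" "\<forall>u\<in>?F (d + 2). (\<Sum>p\<in>B. c' p * u p) = 0"
        using exists_orthogonal_vector[OF fin F(3)] by blast
      have span0: "(\<Sum>p\<in>B. c' p * u p) = 0" if "u \<in> cvec.span (?F (d + 2))" for u
        using that
      proof (induction rule: cvec.span_induct_alt)
        case (step k x y)
        have "(\<Sum>p\<in>B. c' p * (cscale k x + y) p) = k * (\<Sum>p\<in>B. c' p * x p) + (\<Sum>p\<in>B. c' p * y p)"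
          by (simp add: cscale_def algebra_simps sum.distrib sum_distrib_left)
        moreover have "(\<Sum>p\<in>B. c' p * x p) = 0" using c'(2) step.hyps by blast
        ultimately show ?case using step.IH by simp
      qed simp
      have "annihilates c' B (Suc d)"
        unfolding annihilates_monom_on_iff
      proof (intro allI impI)
        fix n assume "n < triangle (Suc (Suc d))"
        then have "monom_on B n \<in> cvec.span (?F (d + 2))"
          unfolding F(4) by (intro cvec.span_base) simp
        then show "(\<Sum>p\<in>B. c' p * monom_on B n p) = 0" by (rule span0)
      qed
      then show False using False c'(1) by blast
    qed
    moreover have "card (?F (Suc s)) + card (?F (Suc (d - s))) \<le> card B"
    proof (rule orthogonal_card_le[of B c])
      fix u v assume "u \<in> ?F (Suc s)" "v \<in> ?F (Suc (d - s))"
      then show "(\<Sum>p\<in>B. c p * u p * v p) = 0"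
        using annihilates_product[of c B s "d - s"] c(2) assms(4) by auto
    qed (rule fin F(1) F(2) | erule c(1))+
    moreover have "fresh_in_degree B i = Suc i" if "i \<le> s" for i
    proof -
      have "fresh (monom_on B) (prod_encode (a, i - a))" if "a \<le> i" for a
        using that \<open>i \<le> s\<close> prod_encode_less_triangle[of a "i - a" s] by (intro full) simp
      then have "{a. a \<le> i \<and> fresh (monom_on B) (prod_encode (a, i - a))} = {..i}" by auto
      then show ?thesis by (simp add: fresh_in_degree_def)
    qed
    ultimately show ?thesis
      using card_bound_of_degree_counts[OF assms(4), of B "card B"] unfolding F(5) by blast
  qed
qed

section \<open>From ternary forms to affine polynomials\<close>

lemma monomial_plane: "monomial 2 v a = v 0 ^ a 0 * v 1 ^ a 1 * v 2 ^ a 2"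
  by (simp add: monomial_def numeral_2_eq_2)

lemma exponent_vector_in_exponents:
  "(\<lambda>k. if k = 0 then a else if k = 1 then b else if k = 2 then c else 0) \<in> exponents 2 (a + b + c)"
  by (auto simp: exponents_def numeral_2_eq_2)

lemma exponents_plane_sum: "a \<in> exponents 2 u \<Longrightarrow> a 0 + a 1 + a 2 = u"
  by (auto simp: exponents_def numeral_2_eq_2)

lemma form_eval_scale: "form_eval n u F (cscale c v) = c ^ u * form_eval n u F v"
  unfolding form_eval_def sum_distrib_left
proof (rule sum.cong)
  fix a assume "a \<in> exponents n u"
  then have "monomial n (cscale c v) a = c ^ u * monomial n v a"
    by (auto simp: monomial_def cscale_def power_mult_distrib prod.distrib exponents_def power_sum[symmetric])
  then show "F a * monomial n (cscale c v) a = c ^ u * (F a * monomial n v a)" by simp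
qed simp

lemma card_exponents_triangle: "card (exponents 2 s) = triangle (Suc s)"
  by (simp add: card_exponents choose_two triangle_def mult.commute)

text \<open>On the affine chart where $x_0 + t x_1 + t^2 x_2 = 1$ the coordinate $x_0$ is the affine polynomial
$1 - t x_1 - t^2 x_2$, so forms of degree \<^term>\<open>s\<close> become polynomials of degree at most
\<^term>\<open>s\<close>.\<close>

lemma dehomogenized_monomial_in_span:
  assumes "e + a + b \<le> s"
  shows "(\<lambda>p. if p \<in> B then (1 - t * fst p - t\<^sup>2 * snd p) ^ e * fst p ^ a * snd p ^ b else 0)
    \<in> cvec.span (monom_on B ` {..<triangle (Suc s)})" (is "?m e a b \<in> ?V")
  using assms
proof (induction e arbitrary: a b)
  case 0
  have "?m 0 a b = monom_on B (prod_encode (a, b))" by (auto simp: monom_on_def)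
  moreover have "prod_encode (a, b) < triangle (Suc s)"
    using 0 prod_encode_less_triangle by simp
  ultimately show ?case by (simp only:) (intro cvec.span_base imageI, simp)
next
  case (Suc e)
  have "?m (Suc e) a b = ?m e a b - cscale t (?m e (Suc a) b) - cscale (t\<^sup>2) (?m e a (Suc b))"
    by (auto simp: cscale_def fun_eq_iff algebra_simps)
  moreover have "?m e a b \<in> ?V" "?m e (Suc a) b \<in> ?V" "?m e a (Suc b) \<in> ?V"
    using Suc.IH[of a b] Suc.IH[of "Suc a" b] Suc.IH[of a "Suc b"] Suc.prems by simp_all
  ultimately show ?case by (simp only:) (intro cvec.span_diff cvec.span_scale)
qed

text \<open>The converse passage from affine polynomials to forms: a monomial of lower degree is multiplied
by a power of $x_0 + t x_1 + t^2 x_2$, which is 1 at all points in question. The number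
\<^term>\<open>n\<close> is the exponent of that power.\<close>

lemma homogeneous_relation_annihilates:
  fixes z0 z1 z2 :: "'i \<Rightarrow> complex"
  assumes rel: "\<And>e0 e1 e2. e0 + e1 + e2 = d \<Longrightarrow> (\<Sum>i\<in>I. c i * (z0 i ^ e0 * z1 i ^ e1 * z2 i ^ e2)) = 0"
    and z: "\<And>i. i \<in> I \<Longrightarrow> z0 i + t * z1 i + t\<^sup>2 * z2 i = 1"
    and "e0 + e1 + e2 + n = d"
  shows "(\<Sum>i\<in>I. c i * (z0 i ^ e0 * z1 i ^ e1 * z2 i ^ e2)) = 0"
  using assms(3)
proof (induction n arbitrary: e0 e1 e2)
  case 0
  then show ?case using rel by simp
next
  case (Suc n)
  let ?S = "\<lambda>e0 e1 e2. (\<Sum>i\<in>I. c i * (z0 i ^ e0 * z1 i ^ e1 * z2 i ^ e2))"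
  have "?S e0 e1 e2 = (\<Sum>i\<in>I. c i * (z0 i ^ e0 * z1 i ^ e1 * z2 i ^ e2) * (z0 i + t * z1 i + t\<^sup>2 * z2 i))"
    using z by (intro sum.cong) auto
  also have "\<dots> = ?S (Suc e0) e1 e2 + t * ?S e0 (Suc e1) e2 + t\<^sup>2 * ?S e0 e1 (Suc e2)"
    unfolding sum_distrib_left sum.distrib[symmetric] by (intro sum.cong) (auto simp: algebra_simps)
  also have "\<dots> = 0"
    using Suc.prems by (simp only: Suc.IH[of "Suc e0" e1 e2] Suc.IH[of e0 "Suc e1" e2] Suc.IH[of e0 e1 "Suc e2"]) simp
  finally show ?case .
qed

text \<open>The bound of Cayley-Bacharach type for points of the projective plane. After the choice of a line
missing all the points, they lie in an affine plane. That all monomials of degree at most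
\<^term>\<open>s\<close> are fresh is a matter of dimension: the restrictions of the forms of degree
\<^term>\<open>s\<close> are linearly independent by \<open>full\<close>, they are as many as these monomials, and they lie
in their span.\<close>

lemma dependent_veronese_card_bound:
  fixes y :: "'q \<Rightarrow> nat \<Rightarrow> complex"
  assumes I: "finite I" "J \<subseteq> I"
    and y: "\<And>i. i \<in> I \<Longrightarrow> y i \<in> coord_space {..2}" "\<And>i. i \<in> I \<Longrightarrow> y i \<noteq> 0"
    and distinct: "\<And>i j. i \<in> I \<Longrightarrow> j \<in> I \<Longrightarrow> cvec.span {y i} = cvec.span {y j} \<Longrightarrow> i = j"
    and c: "\<And>i. i \<in> I \<Longrightarrow> c i \<noteq> 0" "(\<Sum>i\<in>I. cscale (c i) (veronese_vec 2 d (y i))) = 0"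
    and s: "2 * s < d"
    and full: "\<And>F. F \<in> coord_space (exponents 2 s) \<Longrightarrow> (\<And>j. j \<in> J \<Longrightarrow> form_eval 2 s F (y j) = 0) \<Longrightarrow> F = 0"
  shows "(s + 2) * (d + 2) \<le> 2 * card I"
proof -
  have "(y i 0, y i 1, y i 2) \<noteq> (0, 0, 0)" if "i \<in> I" for i
  proof
    assume "(y i 0, y i 1, y i 2) = (0, 0, 0)"
    then have "y i k = 0" for k
      using y(1)[OF that] by (cases "k \<le> 2") (auto simp: coord_space_def le_Suc_eq numeral_2_eq_2)
    then show False using y(2)[OF that] by (simp add: fun_eq_iff)
  qed
  then obtain t where t: "\<And>i. i \<in> I \<Longrightarrow> y i 0 + t * y i 1 + t\<^sup>2 * y i 2 \<noteq> 0"
    using exists_common_non_root[OF I(1), of "\<lambda>i. (y i 0, y i 1, y i 2)"] by auto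
  define l where "l = (\<lambda>i. y i 0 + t * y i 1 + t\<^sup>2 * y i 2)"
  have l: "l i \<noteq> 0" if "i \<in> I" for i using t[OF that] by (simp add: l_def)
  define z where "z = (\<lambda>i k. y i k / l i)"
  have yz: "y i = cscale (l i) (z i)" if "i \<in> I" for i
    using l[OF that] by (auto simp: cscale_def z_def)
  have z: "z i 0 + t * z i 1 + t\<^sup>2 * z i 2 = 1" if "i \<in> I" for i
  proof -
    have "z i 0 + t * z i 1 + t\<^sup>2 * z i 2 = (y i 0 + t * y i 1 + t\<^sup>2 * y i 2) / l i"
      by (simp add: z_def add_divide_distrib)
    also have "\<dots> = l i / l i" by (simp only: l_def)
    finally show ?thesis using l[OF that] by simp
  qed
  define q where "q = (\<lambda>i. (z i 1, z i 2))"
  have inj: "inj_on q I"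
  proof (rule inj_onI)
    fix i j assume ij: "i \<in> I" "j \<in> I" "q i = q j"
    then have z12: "z i 1 = z j 1" "z i 2 = z j 2" by (auto simp: q_def)
    then have "z i 0 = z j 0" using z[OF ij(1)] z[OF ij(2)] by (metis add_right_cancel)
    then have "z i k = z j k" for k
    proof (cases "k \<le> 2")
      case True
      then have "k = 0 \<or> k = 1 \<or> k = 2" by auto
      then show ?thesis using z12 \<open>z i 0 = z j 0\<close> by auto
    next
      case False
      then show ?thesis using y(1)[OF ij(1)] y(1)[OF ij(2)] by (auto simp: coord_space_def z_def)
    qed
    then have "z i = z j" by auto
    moreover have "cvec.span {y i} = cvec.span {z i}" if "i \<in> I" for i
      using cvec.span_image_scale[of "{z i}" "\<lambda>_. l i"] l[OF that] yz[OF that] by simp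
    ultimately show "i = j" using distinct ij by metis
  qed
  define B where "B = q ` I"
  \<comment> \<open>The weights absorb the factors \<^term>\<open>l i ^ d\<close> that rescaling the points puts on degree \<^term>\<open>d\<close>.\<close>
  define C where "C = (\<lambda>p. c (the_inv_into I q p) * l (the_inv_into I q p) ^ d)"
  have C: "C (q i) = c i * l i ^ d" if "i \<in> I" for i
    using the_inv_into_f_f[OF inj that] by (simp add: C_def)
  have B: "finite B" "card B = card I" "\<And>p. p \<in> B \<Longrightarrow> C p \<noteq> 0"
    using I(1) inj card_image[OF inj] c(1) l C by (auto simp: B_def)
  have rel: "(\<Sum>i\<in>I. c i * l i ^ d * (z i 0 ^ e0 * z i 1 ^ e1 * z i 2 ^ e2)) = 0"
    if e: "e0 + e1 + e2 = d" for e0 e1 e2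
  proof -
    define e where "e = (\<lambda>k::nat. if k = 0 then e0 else if k = 1 then e1 else if k = 2 then e2 else 0)"
    have mem: "e \<in> exponents 2 d" unfolding e_def e[symmetric] by (rule exponent_vector_in_exponents)
    have "l i ^ d * (z i 0 ^ e0 * z i 1 ^ e1 * z i 2 ^ e2) = veronese_vec 2 d (y i) e" if "i \<in> I" for i
    proof -
      have "veronese_vec 2 d (y i) = cscale (l i ^ d) (veronese_vec 2 d (z i))"
        by (simp only: yz[OF that] veronese_vec_scale)
      then have "veronese_vec 2 d (y i) e = l i ^ d * veronese_vec 2 d (z i) e"
        by (simp only: cscale_def)
      then show ?thesis using mem by (simp add: veronese_vec_def monomial_plane e_def)
    qed
    then have "(\<Sum>i\<in>I. c i * l i ^ d * (z i 0 ^ e0 * z i 1 ^ e1 * z i 2 ^ e2))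
        = (\<Sum>i\<in>I. cscale (c i) (veronese_vec 2 d (y i))) e"
      unfolding lincomb_apply by (intro sum.cong) (auto simp: mult.assoc)
    then show ?thesis using c(2) by simp
  qed
  have ann: "annihilates C B d"
    unfolding annihilates_def
  proof (intro allI impI)
    fix a b assume "a + b \<le> d"
    then have "(\<Sum>i\<in>I. c i * l i ^ d * (z i 0 ^ 0 * z i 1 ^ a * z i 2 ^ b)) = 0"
      by (intro homogeneous_relation_annihilates[OF rel z, of d _ _ _ "d - (a + b)"]) auto
    then show "(\<Sum>p\<in>B. C p * (fst p ^ a * snd p ^ b)) = 0"
      unfolding B_def sum.reindex[OF inj] using C by (simp add: q_def)
  qed
  have fresh: "fresh (monom_on B) n" if n: "n < triangle (Suc s)" for n
  proof (rule ccontr)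
    assume not: "\<not> fresh (monom_on B) n"
    let ?M = "{n. n < triangle (Suc s) \<and> fresh (monom_on B) n}"
    let ?m = "\<lambda>a p. if p \<in> B then (1 - t * fst p - t\<^sup>2 * snd p) ^ a 0 * fst p ^ a 1 * snd p ^ a (2::nat) else 0"
    have "card ?M < card {..<triangle (Suc s)}"
      using n not by (intro psubset_card_mono) auto
    then have less: "card (monom_on B ` ?M) < card (exponents 2 s)"
      by (simp add: card_fresh card_exponents_triangle)
    have sub: "?m ` exponents 2 s \<subseteq> cvec.span (monom_on B ` ?M)"
    proof
      fix v assume "v \<in> ?m ` exponents 2 s"
      then obtain a where a: "a \<in> exponents 2 s" "v = ?m a" by blast
      have "?m a \<in> cvec.span (monom_on B ` {..<triangle (Suc s)})"
        using exponents_plane_sum[OF a(1)] by (intro dehomogenized_monomial_in_span) simp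
      then show "v \<in> cvec.span (monom_on B ` ?M)"
        using fresh_basis[of "monom_on B" "triangle (Suc s)"] a(2) by simp
    qed
    then obtain F where F: "\<exists>a\<in>exponents 2 s. F a \<noteq> 0" "(\<Sum>a\<in>exponents 2 s. cscale (F a) (?m a)) = 0"
      using exists_linear_relation[OF finite_exponents _ sub less] by auto
    define G where "G = (\<lambda>a. if a \<in> exponents 2 s then F a else 0)"
    have "form_eval 2 s G (y i) = 0" if "i \<in> I" for i
    proof -
      have z0: "1 - t * z i 1 - t\<^sup>2 * z i 2 = z i 0" using z[OF that] by (simp add: algebra_simps)
      have "form_eval 2 s G (z i) = (\<Sum>a\<in>exponents 2 s. F a * ?m a (q i))"
        unfolding form_eval_def
        using that z0 by (intro sum.cong) (auto simp: G_def monomial_plane B_def q_def)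
      also have "\<dots> = (\<Sum>a\<in>exponents 2 s. cscale (F a) (?m a)) (q i)" by (simp only: lincomb_apply)
      also have "\<dots> = 0" unfolding F(2) by simp
      finally show ?thesis by (simp add: yz[OF that] form_eval_scale)
    qed
    moreover have "G \<in> coord_space (exponents 2 s)" by (simp add: G_def coord_space_def)
    ultimately have "G = 0" using full I(2) by blast
    then show False using F(1) by (auto simp: G_def fun_eq_iff split: if_splits)
  qed
  show ?thesis
    using annihilated_card_bound[OF B(1,3) ann s fresh] B(2) by simp
qed

section \<open>Rank and decompositions\<close>

lemma veronese_variety_point:
  assumes "Q \<in> veronese_variety n d"
  obtains y where "y \<in> coord_space {..n}" "y \<noteq> 0" "Q = cvec.span {veronese_vec n d y}"
  using assms unfolding veronese_variety_def proj_space_def by (auto simp: veronese_span)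

lemma expression_in_linear_span:
  assumes "is_expression P Ps" "P \<in> proj_space I"
  shows "in_linear_span P (set Ps)"
proof -
  obtain w where P: "P = cvec.span {w}" using assms(2) by (auto simp: proj_space_def)
  obtain vs where vs: "list_all2 (\<lambda>v Q. v \<in> Q \<and> v \<noteq> 0) vs Ps" "sum_list vs \<in> P" "sum_list vs \<noteq> 0"
    using assms(1) by (auto simp: is_expression_def)
  have "sum_list vs \<in> cvec.span (\<Union>(set Ps))"
    using vs(1)
  proof (induction vs Ps rule: list_all2_induct)
    case Nil
    show ?case by (simp only: sum_list.Nil cvec.span_zero)
  next
    case (Cons v vs Q Ps)
    have "cvec.span (\<Union>(set Ps)) \<subseteq> cvec.span (\<Union>(set (Q # Ps)))" by (intro cvec.span_mono) auto
    moreover have "v \<in> cvec.span (\<Union>(set (Q # Ps)))" using Cons by (intro cvec.span_base) auto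
    ultimately have "v + sum_list vs \<in> cvec.span (\<Union>(set (Q # Ps)))"
      using Cons.IH by (intro cvec.span_add) auto
    then show ?case by (simp only: sum_list.Cons)
  qed
  moreover obtain a where a: "sum_list vs = cscale a w"
    using vs(2) by (auto simp: P cvec.span_singleton)
  moreover have "w = cscale (1 / a) (sum_list vs)"
    using a vs(3) by (auto simp: cscale_def fun_eq_iff)
  ultimately have "w \<in> cvec.span (\<Union>(set Ps))" using cvec.span_scale by metis
  then show ?thesis
    unfolding in_linear_span_def P by (intro cvec.span_minimal cvec.subspace_span) auto
qed

text \<open>Applied to a set with exactly as many points as the rank, this shows that every coefficient of the
decomposition is nonzero.\<close>

lemma decomposition_uses_rank_many_points:
  assumes S: "finite S" "S \<subseteq> veronese_variety n d"
    and y: "\<And>Q. Q \<in> S \<Longrightarrow> Q = cvec.span {veronese_vec n d (y Q)}"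
    and P: "P = cvec.span {w}" "w \<noteq> 0" "in_linear_span P S"
  obtains c where "w = (\<Sum>Q\<in>S. cscale (c Q) (veronese_vec n d (y Q)))"
    "veronese_rank n d P \<le> card {Q \<in> S. c Q \<noteq> 0}"
proof -
  let ?u = "\<lambda>Q. veronese_vec n d (y Q)"
  have "\<Union>S \<subseteq> cvec.span (?u ` S)"
  proof
    fix v assume "v \<in> \<Union>S"
    then obtain Q where Q: "Q \<in> S" "v \<in> Q" by blast
    then have "v \<in> cvec.span {?u Q}" using y by blast
    moreover have "cvec.span {?u Q} \<subseteq> cvec.span (?u ` S)" using Q by (intro cvec.span_mono) auto
    ultimately show "v \<in> cvec.span (?u ` S)" by blast
  qed
  then have "cvec.span (\<Union>S) \<subseteq> cvec.span (?u ` S)"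
    by (intro cvec.span_minimal cvec.subspace_span)
  moreover have "w \<in> cvec.span (\<Union>S)"
    using P(3) unfolding in_linear_span_def P(1) by (meson cvec.span_base singletonI subsetD)
  ultimately obtain c where c: "w = (\<Sum>Q\<in>S. cscale (c Q) (?u Q))"
    using in_span_image_iff[OF S(1), of w ?u] by blast
  define S' where "S' = {Q \<in> S. c Q \<noteq> 0}"
  obtain Qs where Qs: "set Qs = S'" "distinct Qs"
    using finite_distinct_list[of S'] S(1) by (auto simp: S'_def)
  have u: "?u Q \<noteq> 0" if "Q \<in> S" for Q
  proof
    assume "?u Q = 0"
    then have "Q = {0}" using y[OF that] by simp
    moreover have "Q \<in> veronese_target n d" using that S(2) veronese_variety_subset by blast
    then obtain v where "Q = cvec.span {v}" "v \<noteq> 0" by (auto simp: proj_space_def)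
    ultimately show False using cvec.span_base[of v "{v}"] by simp
  qed
  define vs where "vs = map (\<lambda>Q. cscale (c Q) (?u Q)) Qs"
  have "sum_list vs = (\<Sum>Q\<in>S'. cscale (c Q) (?u Q))"
    using Qs by (simp add: vs_def sum_list_distinct_conv_sum_set)
  also have "\<dots> = w"
    unfolding c using S(1) by (intro sum.mono_neutral_left) (auto simp: S'_def)
  finally have "sum_list vs = w" .
  moreover have "list_all2 (\<lambda>v Q. v \<in> Q \<and> v \<noteq> 0) vs Qs"
    unfolding vs_def list_all2_map1
  proof (rule list.rel_refl_strong)
    fix Q assume "Q \<in> set Qs"
    then have Q: "Q \<in> S" "c Q \<noteq> 0" using Qs by (auto simp: S'_def)
    have "cscale (c Q) (?u Q) \<in> cvec.span {?u Q}" by (intro cvec.span_scale cvec.span_base) simp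
    then show "cscale (c Q) (?u Q) \<in> Q \<and> cscale (c Q) (?u Q) \<noteq> 0"
      using y[OF Q(1)] u[OF Q(1)] Q(2) by simp
  qed
  moreover have "w \<in> P" unfolding P(1) by (simp add: cvec.span_base)
  ultimately have "is_expression P Qs" unfolding is_expression_def using P(2) by blast
  moreover have "set Qs \<subseteq> veronese_variety n d" using Qs S(2) by (auto simp: S'_def)
  ultimately have "veronese_rank n d P \<le> length Qs"
    unfolding veronese_rank_def by (intro Least_le) blast
  then have "veronese_rank n d P \<le> card S'" using Qs distinct_card by metis
  then show ?thesis using that c unfolding S'_def by blast
qed

lemma GUP_no_vanishing_form:
  assumes "GUP 2 Z" "Z' \<subseteq> Z" "(u + 2) choose 2 \<le> card Z'" "0 < card Z'"
    and F: "F \<in> coord_space (exponents 2 u)"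
    and van: "\<And>v. cvec.span {v} \<in> Z' \<Longrightarrow> form_eval 2 u F v = 0"
  shows "F = 0"
proof (rule ccontr)
  assume "F \<noteq> 0"
  define H where "H = {x \<in> PP 2. \<forall>v\<in>x. form_eval 2 u F v = 0}"
  have "is_hypersurface 2 u H"
    unfolding is_hypersurface_def H_def using F \<open>F \<noteq> 0\<close> by blast
  moreover have "Z' \<subseteq> H"
  proof
    fix x assume x: "x \<in> Z'"
    then have "x \<in> PP 2" using assms(1,2) by (auto simp: GUP_def)
    then obtain v where v: "x = cvec.span {v}" by (auto simp: proj_space_def)
    have "form_eval 2 u F v' = 0" if "v' \<in> x" for v'
      using that van x unfolding v by (auto simp: cvec.span_singleton form_eval_scale)
    then show "x \<in> H" using \<open>x \<in> PP 2\<close> by (simp add: H_def)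
  qed
  moreover have "card Z' \<in> {1..card Z}"
    using assms(1,2,4) card_mono[of Z Z'] by (auto simp: GUP_def)
  ultimately show False
    using assms(1-3) unfolding GUP_def by blast
qed

section \<open>Identifiability\<close>

text \<open>Here \<^term>\<open>m\<close> is the number of points of \<open>Z\<close> that occur in a relation, and \<^term>\<open>s\<close> is the
largest degree in which their number excludes curves through all of them. If
$s < d / 2 - 2$, the second hypothesis contradicts the third; otherwise the first one does.\<close>

lemma size_bounds_incompatible:
  fixes d s m :: nat
  assumes "8 * m < d * (d + 2)" "2 * m < (s + 2) * (s + 3)" "(s + 2) * (d + 2) \<le> 4 * m"
  shows False
proof (cases "d \<le> 2 * s + 4")
  case True
  then have "d * (d + 2) \<le> (2 * s + 4) * (d + 2)" by (rule mult_right_mono) simp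
  also have "\<dots> = 2 * ((s + 2) * (d + 2))" by (simp add: algebra_simps)
  finally show False using assms(1,3) by linarith
next
  case False
  then have "(s + 2) * (2 * s + 7) \<le> (s + 2) * (d + 2)" by (intro mult_left_mono) auto
  moreover have "(s + 2) * (2 * s + 7) = 2 * ((s + 2) * (s + 3)) + (s + 2)" by (simp add: algebra_simps)
  ultimately show False using assms(2,3) by linarith
qed

lemma exists_triangle_bracket:
  assumes "0 < m"
  obtains s where "triangle (Suc s) \<le> m" "m < triangle (Suc (Suc s))"
proof -
  define s where "s = (LEAST s. m < triangle (Suc (Suc s)))"
  have "m < triangle (Suc (Suc m))" by simp
  then have "m < triangle (Suc (Suc s))" unfolding s_def by (rule LeastI)
  moreover have "triangle (Suc s) \<le> m"
  proof (cases s)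
    case (Suc s')
    then show ?thesis using not_less_Least[of s' "\<lambda>s. m < triangle (Suc (Suc s))"] unfolding s_def by auto
  qed (use assms in simp)
  ultimately show ?thesis using that by blast
qed

text \<open>Uniqueness: let \<open>S\<close> be a decomposition different from the given one \<open>S0\<close>. Subtracting the two
expressions leaves a relation whose support \<open>I\<close> contains the whole symmetric difference. Since
\<open>S\<close> and \<open>S0\<close> have the same size, at least half of the points of \<open>I\<close> belong to \<open>S0\<close>.\<close>

theorem theorem1p4:
  fixes d k :: nat
    and P :: "((nat \<Rightarrow> nat) \<Rightarrow> complex) set"
    and x :: "nat \<Rightarrow> (nat \<Rightarrow> complex) set"
  assumes "d \<ge> 1"
    and "P \<in> veronese_target 2 d"
    and "veronese_rank 2 d P = k"
    and "\<And>i. i < k \<Longrightarrow> x i \<in> PP 2"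
    and "is_expression P (map (\<lambda>i. veronese 2 d (x i)) [0..<k])"
    and "GUP 2 (x ` {..<k})"
    and "real k < (real d ^ 2 + 2 * real d) / 8"
  shows "identifiable 2 d P"
proof -
  define S0 where "S0 = set (map (\<lambda>i. veronese 2 d (x i)) [0..<k])"
  define Z where "Z = x ` {..<k}"
  obtain w where w: "P = cvec.span {w}" "w \<noteq> 0" using assms(2) by (auto simp: proj_space_def)
  have S0: "finite S0" "S0 \<subseteq> veronese_variety 2 d" "in_linear_span P S0"
    using assms(4) expression_in_linear_span[OF assms(5,2)] by (auto simp: S0_def veronese_variety_def)
  have "\<exists>y. Q = cvec.span {veronese_vec 2 d y}" if "Q \<in> S0" for Q
    using that S0(2) veronese_variety_point by (metis subsetD)
  then obtain y0 where "\<And>Q. Q \<in> S0 \<Longrightarrow> Q = cvec.span {veronese_vec 2 d (y0 Q)}" by metis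
  then have "k \<le> card S0"
    using decomposition_uses_rank_many_points[OF S0(1,2) _ w S0(3), of y0] card_mono[OF S0(1)] assms(3)
    by (smt (verit, best) le_trans mem_Collect_eq subsetI)
  moreover have "card S0 \<le> k"
    using card_length[of "map (\<lambda>i. veronese 2 d (x i)) [0..<k]"] by (simp add: S0_def)
  ultimately have card_S0: "card S0 = k" by simp
  have unique: "S = S0"
    if S: "S \<subseteq> veronese_variety 2 d" "finite S" "card S = k" "in_linear_span P S" for S
  proof (rule ccontr)
    assume "S \<noteq> S0"
    have "\<exists>y. y \<in> coord_space {..2} \<and> y \<noteq> 0 \<and> Q = cvec.span {veronese_vec 2 d y}
        \<and> (Q \<in> S0 \<longrightarrow> cvec.span {y} \<in> Z)" if Q: "Q \<in> S \<union> S0" for Q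
    proof (cases "Q \<in> S0")
      case True
      then obtain i where i: "i < k" "Q = veronese 2 d (x i)" by (auto simp: S0_def)
      obtain v where v: "x i = cvec.span {v}" "v \<in> coord_space {..2}" "v \<noteq> 0"
        using assms(4)[OF i(1)] by (auto simp: proj_space_def)
      then show ?thesis using i by (intro exI[of _ v]) (auto simp: veronese_span Z_def)
    next
      case False
      then have "Q \<in> veronese_variety 2 d" using Q S(1) by blast
      then show ?thesis using False by (metis veronese_variety_point)
    qed
    then obtain y where y: "\<And>Q. Q \<in> S \<union> S0 \<Longrightarrow> y Q \<in> coord_space {..2}"
      "\<And>Q. Q \<in> S \<union> S0 \<Longrightarrow> y Q \<noteq> 0"
      "\<And>Q. Q \<in> S \<union> S0 \<Longrightarrow> Q = cvec.span {veronese_vec 2 d (y Q)}"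
      "\<And>Q. Q \<in> S0 \<Longrightarrow> cvec.span {y Q} \<in> Z"
      by (metis UnI2)
    \<comment> \<open>By minimality of the rank, both decompositions have only nonzero coefficients.\<close>
    have coeffs: "\<exists>c. w = (\<Sum>Q\<in>T. cscale (c Q) (veronese_vec 2 d (y Q))) \<and> (\<forall>Q\<in>T. c Q \<noteq> 0)"
      if T: "finite T" "T \<subseteq> veronese_variety 2 d" "in_linear_span P T" "card T = k" "T \<subseteq> S \<union> S0" for T
    proof -
      have yT: "Q = cvec.span {veronese_vec 2 d (y Q)}" if "Q \<in> T" for Q using y(3) that T(5) by blast
      obtain c where c: "w = (\<Sum>Q\<in>T. cscale (c Q) (veronese_vec 2 d (y Q)))"
        "veronese_rank 2 d P \<le> card {Q \<in> T. c Q \<noteq> 0}"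
        by (rule decomposition_uses_rank_many_points[OF T(1,2) yT w T(3)])
      then have "{Q \<in> T. c Q \<noteq> 0} = T"
        using T(1,4) assms(3) by (intro card_seteq) auto
      then show ?thesis using c(1) by blast
    qed
    obtain a where a: "w = (\<Sum>Q\<in>S0. cscale (a Q) (veronese_vec 2 d (y Q)))" "\<And>Q. Q \<in> S0 \<Longrightarrow> a Q \<noteq> 0"
      using coeffs[OF S0 card_S0] by blast
    obtain b where b: "w = (\<Sum>Q\<in>S. cscale (b Q) (veronese_vec 2 d (y Q)))" "\<And>Q. Q \<in> S \<Longrightarrow> b Q \<noteq> 0"
      using coeffs[OF S(2,1,4,3)] by blast
    define c where "c = (\<lambda>Q. (if Q \<in> S0 then a Q else 0) - (if Q \<in> S then b Q else 0))"
    define I where "I = {Q \<in> S \<union> S0. c Q \<noteq> 0}"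
    define J where "J = I \<inter> S0"
    have fin: "finite I" "finite J" using S(2) S0(1) by (auto simp: I_def J_def)
    have "(\<Sum>Q\<in>S \<union> S0. c Q * f Q) = (\<Sum>Q\<in>S0. a Q * f Q) - (\<Sum>Q\<in>S. b Q * f Q)" for f
    proof -
      have "(\<Sum>Q\<in>S \<union> S0. c Q * f Q) = (\<Sum>Q\<in>S \<union> S0. if Q \<in> S0 then a Q * f Q else 0)
          - (\<Sum>Q\<in>S \<union> S0. if Q \<in> S then b Q * f Q else 0)"
        unfolding sum_subtractf[symmetric] by (intro sum.cong) (auto simp: c_def algebra_simps)
      also have "\<dots> = (\<Sum>Q\<in>S0. a Q * f Q) - (\<Sum>Q\<in>S. b Q * f Q)"
        using S(2) S0(1) by (simp add: sum.inter_restrict[symmetric] Int_absorb1 Int_commute)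
      finally show ?thesis .
    qed
    then have "(\<Sum>Q\<in>S \<union> S0. cscale (c Q) (veronese_vec 2 d (y Q))) = w - w"
      by (subst (1) a(1), subst b(1)) (simp add: fun_eq_iff lincomb_apply)
    moreover have "(\<Sum>Q\<in>I. cscale (c Q) (veronese_vec 2 d (y Q))) = (\<Sum>Q\<in>S \<union> S0. cscale (c Q) (veronese_vec 2 d (y Q)))"
      using S(2) S0(1) by (intro sum.mono_neutral_left) (auto simp: I_def)
    ultimately have rel: "(\<Sum>Q\<in>I. cscale (c Q) (veronese_vec 2 d (y Q))) = 0" by simp
    have diff: "card (S - S0) = card (S0 - S)"
      using card_Diff_subset_Int[of S S0] card_Diff_subset_Int[of S0 S] S(2,3) S0(1) card_S0
      by (simp add: Int_commute)
    have J_sup: "S0 - S \<subseteq> J" using a(2) by (auto simp: J_def I_def c_def)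
    have "card I \<le> card (J \<union> (S - S0))"
      using fin S(2) by (intro card_mono) (auto simp: I_def J_def)
    also have "\<dots> \<le> card J + card (S - S0)" by (rule card_Un_le)
    also have "\<dots> \<le> 2 * card J" using diff card_mono[OF fin(2) J_sup] by simp
    finally have card_I: "card I \<le> 2 * card J" .
    have "S0 - S \<noteq> {}"
      using \<open>S \<noteq> S0\<close> S(2,3) card_S0 card_subset_eq[of S S0] by blast
    then have "0 < card J" using J_sup fin(2) by (metis card_gt_0_iff subset_empty)
    then obtain s where s: "triangle (Suc s) \<le> card J" "card J < triangle (Suc (Suc s))"
      by (rule exists_triangle_bracket)
    have "card J \<le> k" using card_mono[OF S0(1), of J] card_S0 by (simp add: J_def)
    moreover have "real (8 * k) < real (d * (d + 2))"
      using assms(7) by (simp add: power2_eq_square algebra_simps)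
    ultimately have small: "8 * card J < d * (d + 2)" by linarith
    have "2 * s < d"
    proof (rule ccontr)
      assume "\<not> 2 * s < d"
      then have "d * (d + 2) \<le> (2 * s) * (2 * s + 2)" by (intro mult_mono) auto
      also have "\<dots> \<le> 4 * (Suc s * Suc (Suc s))" by simp
      finally show False using small s(1) double_triangle[of "Suc s"] by linarith
    qed
    have y_inj: "Q = R" if "Q \<in> S \<union> S0" "R \<in> S \<union> S0" "cvec.span {y Q} = cvec.span {y R}" for Q R
      using y(3)[OF that(1)] y(3)[OF that(2)] that(3) veronese_span by metis
    \<comment> \<open>General uniform position passes to the points of \<open>Z\<close> in the support of the relation.\<close>
    define Z' where "Z' = (\<lambda>Q. cvec.span {y Q}) ` J"
    have "inj_on (\<lambda>Q. cvec.span {y Q}) J"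
      using y_inj by (auto intro!: inj_onI simp: J_def)
    then have "card Z' = card J" unfolding Z'_def by (rule card_image)
    have bound: "(s + 2) * (d + 2) \<le> 2 * card I"
    proof (rule dependent_veronese_card_bound[where J = J and y = y and c = c])
      fix F assume F: "F \<in> coord_space (exponents 2 s)" "\<And>Q. Q \<in> J \<Longrightarrow> form_eval 2 s F (y Q) = 0"
      show "F = 0"
      proof (rule GUP_no_vanishing_form[OF assms(6) _ _ _ F(1)])
        show "Z' \<subseteq> x ` {..<k}" using y(4) by (auto simp: Z'_def J_def Z_def)
        show "s + 2 choose 2 \<le> card Z'"
          using s(1) card_exponents_triangle[of s] card_exponents[of 2 s] \<open>card Z' = card J\<close>
          by (simp add: add.commute)
        show "0 < card Z'" using \<open>0 < card J\<close> \<open>card Z' = card J\<close> by simp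
        fix v assume "cvec.span {v} \<in> Z'"
        then obtain Q where Q: "Q \<in> J" "cvec.span {v} = cvec.span {y Q}" by (auto simp: Z'_def)
        then have "v \<in> cvec.span {y Q}" using cvec.span_base[of v "{v}"] by simp
        then show "form_eval 2 s F v = 0"
          using F(2)[OF Q(1)] by (auto simp: cvec.span_singleton form_eval_scale)
      qed
    qed (use fin y y_inj rel \<open>2 * s < d\<close> in \<open>auto simp: I_def J_def\<close>)
    have "2 * triangle (Suc (Suc s)) = (s + 2) * (s + 3)"
      unfolding double_triangle by (simp add: eval_nat_numeral)
    then have "2 * card J < (s + 2) * (s + 3)" using s(2) by linarith
    moreover have "(s + 2) * (d + 2) \<le> 4 * card J" using bound card_I by linarith
    ultimately show False by (rule size_bounds_incompatible[OF small])
  qed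
  show ?thesis
    unfolding identifiable_def assms(3)
  proof (rule ex1I)
    show "S0 \<subseteq> veronese_variety 2 d \<and> finite S0 \<and> card S0 = k \<and> in_linear_span P S0"
      by (intro conjI S0 card_S0)
  qed (elim conjE, rule unique)
qed

end
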